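(* Let $(X,\tau_1,\tau_2)$ be a bitopological space with $\tau_1<_C\tau_2$ which is $p$-normal, $p$-connected and $(2,1)$-nodec, such that $(X,\tau_1)$ is $T_1$ and every 2-closed subset of $X$ is $(1,2)$-WS-supernormal in $X$. Then $(X,\tau_1,\tau_2)$ is a $(1,2)$-Baire space and, hence, $(X,\tau_1)$ is a Baire space.
   Context: A bitopological space $(X,\tau_1,\tau_2)$ is a set with two topologies; $\tau_i\mathrm{cl}$, $\tau_i\mathrm{int}$ are closure and interior in $\tau_i$; "$i$-open", "$i$-closed" refer to $\tau_i$; $\mathrm{co}\,\tau_i$ is the family of $\tau_i$-closed sets. Subsets carry the induced bitopological subspace structure $(Y,\tau_1',\tau_2')$. Always $i,j\in\{1,2\}$, $i\ne j$. $\tau_1<_C\tau_2$ means: $\tau_1\subset\tau_2$ and $\tau_1\mathrm{cl}\,U\subseteq\tau_2\mathrm{cl}\,U$ for every $U\in\tau_1$. $p$-normal: for every pair of disjoint sets $A,B$ in $X$ with $A$ 1-closed and $B$ 2-closed there are a 2-open set $U$ and a 1-open set $V$ such that $A\subset U$, $B\subset V$, $U\cap V=\varnothing$. $p$-connected: $X$ cannot be expressed as a union of two disjoint sets $A\in\tau_1\setminus\{\varnothing\}$ and $B\in\tau_2\setminus\{\varnothing\}$. A set $A$ is $(i,j)$-nowhere dense if $\tau_i\mathrm{int}\,\tau_j\mathrm{cl}\,A=\varnothing$. A set $A$ is $i$-discrete if each point of $A$ is isolated in $A$ with respect to $\tau_i$. $X$ is $(i,j)$-nodec if every $(i,j)$-nowhere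 dense subset is $j$-closed and $i$-discrete. (So $(2,1)$-nodec: every $A$ with $\tau_2\mathrm{int}\,\tau_1\mathrm{cl}\,A=\varnothing$ is 1-closed and 2-discrete.) A subspace $(Y,\tau_1',\tau_2')$ is $(1,2)$-WS-supernormal in $X$ if for each pair of disjoint sets $A\in\mathrm{co}\,\tau_1'$, $B\in\mathrm{co}\,\tau_2$ there are disjoint $U\in\tau_2'$, $V\in\tau_1$ with $A\subset U$, $B\subset V$. A bitopological space is of $(i,j)$-first category (in itself) if it is a countable union of $(i,j)$-nowhere dense subsets of itself, and of $(i,j)$-second category otherwise; a subset is of $(i,j)$-first (second) category if it is so as a bitopological subspace. $X$ is an $(i,j)$-Baire space if every nonempty $i$-open subset of $X$ is of $(i,j)$-second category. *)

theory Defs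
  imports "HOL-Analysis.Analysis"
begin

text \<open>
  A bitopological space is a pair of topologies with a common underlying set. Below, \<open>S\<close> and \<open>T\<close>
  stand for the two topologies in the order in which the indices appear in the name of the notion:
  an \<open>(i,j)\<close>-property is the predicate applied to \<open>\<tau>\<^sub>i\<close> and \<open>\<tau>\<^sub>j\<close> in this order.
\<close>

definition bitopological_space :: "'a topology \<Rightarrow> 'a topology \<Rightarrow> bool" where
  "bitopological_space S T \<longleftrightarrow> topspace S = topspace T"

definition less_C :: "'a topology \<Rightarrow> 'a topology \<Rightarrow> bool" where
  "less_C S T \<longleftrightarrow>
     (\<forall>U. openin S U \<longrightarrow> openin T U) \<and>
     (\<forall>U. openin S U \<longrightarrow> S closure_of U \<subseteq> T closure_of U)"

definition p_normal :: "'a topology \<Rightarrow> 'a topology \<Rightarrow> bool" where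
  "p_normal S T \<longleftrightarrow>
     (\<forall>A B. closedin S A \<and> closedin T B \<and> disjnt A B \<longrightarrow>
        (\<exists>U V. openin T U \<and> openin S V \<and> A \<subseteq> U \<and> B \<subseteq> V \<and> disjnt U V))"

definition p_connected :: "'a topology \<Rightarrow> 'a topology \<Rightarrow> bool" where
  "p_connected S T \<longleftrightarrow>
     \<not> (\<exists>A B. openin S A \<and> A \<noteq> {} \<and> openin T B \<and> B \<noteq> {} \<and> disjnt A B \<and> topspace S = A \<union> B)"

definition bi_nowhere_dense :: "'a topology \<Rightarrow> 'a topology \<Rightarrow> 'a set \<Rightarrow> bool" where
  "bi_nowhere_dense S T A \<longleftrightarrow> A \<subseteq> topspace S \<and> S interior_of (T closure_of A) = {}"

definition discrete_in :: "'a topology \<Rightarrow> 'a set \<Rightarrow> bool" where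
  "discrete_in T A \<longleftrightarrow> A \<subseteq> topspace T \<and> (\<forall>x\<in>A. \<exists>U. openin T U \<and> U \<inter> A = {x})"

text \<open>Closedness is required with respect to the second topology, discreteness with respect to
  the first.\<close>

definition bi_nodec :: "'a topology \<Rightarrow> 'a topology \<Rightarrow> bool" where
  "bi_nodec S T \<longleftrightarrow> (\<forall>A. bi_nowhere_dense S T A \<longrightarrow> closedin T A \<and> discrete_in S A)"

text \<open>The set \<open>A\<close> is closed in the subspace \<open>Y\<close> while \<open>B\<close> is closed in the whole space; likewise
  for \<open>U\<close> and \<open>V\<close>.\<close>

definition WS_supernormal_in :: "'a topology \<Rightarrow> 'a topology \<Rightarrow> 'a set \<Rightarrow> bool" where
  "WS_supernormal_in S T Y \<longleftrightarrow> Y \<subseteq> topspace S \<and>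
     (\<forall>A B. closedin (subtopology S Y) A \<and> closedin T B \<and> disjnt A B \<longrightarrow>
        (\<exists>U V. openin (subtopology T Y) U \<and> openin S V \<and> A \<subseteq> U \<and> B \<subseteq> V \<and> disjnt U V))"

definition bi_first_category :: "'a topology \<Rightarrow> 'a topology \<Rightarrow> bool" where
  "bi_first_category S T \<longleftrightarrow>
     (\<exists>\<A>. countable \<A> \<and> (\<forall>A\<in>\<A>. bi_nowhere_dense S T A) \<and> topspace S = \<Union>\<A>)"

abbreviation bi_second_category :: "'a topology \<Rightarrow> 'a topology \<Rightarrow> bool" where
  "bi_second_category S T \<equiv> \<not> bi_first_category S T"

definition bi_Baire_space :: "'a topology \<Rightarrow> 'a topology \<Rightarrow> bool" where
  "bi_Baire_space S T \<longleftrightarrow>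
     (\<forall>U. openin S U \<and> U \<noteq> {} \<longrightarrow> bi_second_category (subtopology S U) (subtopology T U))"

definition Baire_space :: "'a topology \<Rightarrow> bool" where
  "Baire_space T \<longleftrightarrow>
     (\<forall>\<G>. countable \<G> \<and> (\<forall>G\<in>\<G>. openin T G \<and> T closure_of G = topspace T) \<longrightarrow>
        T closure_of (\<Inter>\<G>) = topspace T)"

text \<open>The Baire property of a single topology agrees with the bitopological notion for two equal
  topologies, that is, with the condition that every nonempty open subset is of second category.\<close>

lemma Baire_space_iff_bi_Baire_space: "Baire_space T \<longleftrightarrow> bi_Baire_space T T"
proof
  assume B: "Baire_space T"
  show "bi_Baire_space T T"
    unfolding bi_Baire_space_def
  proof (intro allI impI notI)
    fix U
    assume U: "openin T U \<and> U \<noteq> {}"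
      and "bi_first_category (subtopology T U) (subtopology T U)"
    moreover have US: "U \<subseteq> topspace T"
      using U openin_subset by blast
    ultimately obtain \<A> where "countable \<A>" and UA: "U = \<Union>\<A>"
      and nd: "\<And>N. N \<in> \<A> \<Longrightarrow> subtopology T U interior_of (subtopology T U closure_of N) = {}"
      unfolding bi_first_category_def bi_nowhere_dense_def
      by (metis inf.absorb_iff2 topspace_subtopology)
    define \<G> where "\<G> = (\<lambda>N. topspace T - T closure_of N) ` \<A>"
    have "T closure_of (topspace T - T closure_of N) = topspace T" if N: "N \<in> \<A>" for N
    proof -
      have "(topspace T - T closure_of N) \<inter> W \<noteq> {}" if W: "openin T W" "W \<noteq> {}" for W
      proof
        assume "(topspace T - T closure_of N) \<inter> W = {}"
        then have sub: "W \<subseteq> T closure_of N"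
          using W openin_subset by fastforce
        have "W \<inter> N \<noteq> {}"
          using sub W unfolding closure_of_def by blast
        then have ne: "W \<inter> U \<noteq> {}"
          using N UA by blast
        have "openin (subtopology T U) (W \<inter> U)"
          using W openin_subtopology by blast
        moreover have "N \<subseteq> U"
          using N UA by blast
        then have "W \<inter> U \<subseteq> subtopology T U closure_of N"
          using sub by (auto simp: closure_of_subtopology inf.absorb2)
        ultimately show False
          using nd[OF N] ne interior_of_maximal by blast
      qed
      then show ?thesis
        by (simp add: dense_intersects_open)
    qed
    then have "\<forall>G\<in>\<G>. openin T G \<and> T closure_of G = topspace T"
      unfolding \<G>_def by (simp add: openin_diff)
    moreover have "countable \<G>"
      unfolding \<G>_def using \<open>countable \<A>\<close> by (rule countable_image)
    ultimately have "T closure_of (\<Inter>\<G>) = topspace T"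
      using B unfolding Baire_space_def by blast
    then have "\<Inter>\<G> \<inter> U \<noteq> {}"
      using U unfolding dense_intersects_open by blast
    then obtain x where x: "x \<in> \<Inter>\<G>" "x \<in> U"
      by blast
    then obtain N where N: "N \<in> \<A>" "x \<in> N"
      using UA by blast
    then have "x \<in> T closure_of N"
      using closure_of_subset[of N T] US UA by blast
    then show False
      using x N unfolding \<G>_def by blast
  qed
next
  assume B: "bi_Baire_space T T"
  show "Baire_space T"
    unfolding Baire_space_def
  proof (intro allI impI)
    fix \<G>
    assume G: "countable \<G> \<and> (\<forall>G\<in>\<G>. openin T G \<and> T closure_of G = topspace T)"
    have "\<Inter>\<G> \<inter> W \<noteq> {}" if W: "openin T W" "W \<noteq> {}" for W
    proof
      assume e: "\<Inter>\<G> \<inter> W = {}"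
      have top: "topspace (subtopology T W) = W"
        using W openin_subset by (metis topspace_subtopology_subset)
      have "bi_nowhere_dense (subtopology T W) (subtopology T W) (W - G)" if "G \<in> \<G>" for G
      proof -
        have "openin (subtopology T W) (W \<inter> G)"
          using G that openin_subtopology_Int2 by blast
        then have "closedin (subtopology T W) (W - G)"
          unfolding closedin_def top by (simp add: Diff_Diff_Int)
        then have cl: "subtopology T W closure_of (W - G) = W - G"
          by (simp add: closure_of_closedin)
        have "subtopology T W interior_of (W - G) = {}"
        proof (rule ccontr)
          assume ne: "subtopology T W interior_of (W - G) \<noteq> {}"
          have "openin T (subtopology T W interior_of (W - G))"
            using W openin_interior_of openin_trans_full by blast
          then have "G \<inter> subtopology T W interior_of (W - G) \<noteq> {}"
            using ne G that by (metis dense_intersects_open)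
          then show False
            using interior_of_subset[of "subtopology T W" "W - G"] by blast
        qed
        then show ?thesis
          unfolding bi_nowhere_dense_def cl top by blast
      qed
      moreover have "W = \<Union>((\<lambda>G. W - G) ` \<G>)"
        using e by blast
      ultimately have "bi_first_category (subtopology T W) (subtopology T W)"
        unfolding bi_first_category_def
        using G top by (intro exI[of _ "(\<lambda>G. W - G) ` \<G>"]) auto
      then show False
        using B W unfolding bi_Baire_space_def by blast
    qed
    then show "T closure_of (\<Inter>\<G>) = topspace T"
      by (simp add: dense_intersects_open)
  qed
qed

end

theory Submission
  imports Defs
begin

text \<open>
  Applied to a 2-closed set \<open>Y\<close> and to \<open>A = Y\<close> inside it, WS-supernormality separates \<open>Y\<close> from every
  outside point by a 1-open set, so \<open>Y\<close> is 1-closed. Hence the two topologies coincide, and the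
  claim is that a connected normal \<open>T\<^sub>1\<close> nodec space is Baire. If a nonempty open set \<open>U\<close> were a
  countable union of nowhere dense sets, all subsets of these sets would be closed. As in the
  countable sum theorem for zero-dimensionality, disjoint closed sets whose union contains the
  complement of \<open>U\<close> could then be enlarged step by step, absorbing one nowhere dense set at a time,
  to a clopen partition of the whole space, against connectedness.
\<close>

text \<open>Normality separates \<open>A\<close> and \<open>B\<close> by open sets with disjoint
  closures; these closures serve as \<open>E\<close> and \<open>F\<close>. Being closed again, they
  can be separated anew, so the construction iterates.\<close>

lemma normal_space_disjoint_closed_neighbourhoods:
  assumes "normal_space X" "closedin X A" "closedin X B" "disjnt A B"
  obtains E F where "closedin X E" "closedin X F" "disjnt E F"
    "A \<subseteq> X interior_of E" "B \<subseteq> X interior_of F"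
proof -
  obtain U V where U: "openin X U" "A \<subseteq> U" and V: "openin X V" "B \<subseteq> V"
    and UV: "disjnt (X closure_of U) (X closure_of V)"
    using assms(1)[unfolded normal_space_disjoint_closures, rule_format, of A B] assms(2-4) by metis
  have "U \<subseteq> X interior_of (X closure_of U)" "V \<subseteq> X interior_of (X closure_of V)"
    using U(1) V(1) by (simp_all add: closure_of_subset interior_of_maximal openin_subset)
  moreover have "closedin X (X closure_of U)" "closedin X (X closure_of V)"
    by simp_all
  ultimately show thesis
    using that U(2) V(2) UV by (meson order_trans)
qed

text \<open>Disjoint closed pairs grow from \<open>(A, B)\<close>: step \<open>n\<close> absorbs
  \<open>D n\<close> and places each set in the interior of its successor. The unions of the two
  chains are therefore open, disjoint and cover the space.\<close>

lemma normal_space_clopen_partition: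
  fixes D :: "nat \<Rightarrow> 'a set"
  assumes X: "normal_space X" and A: "closedin X A" and B: "closedin X B" and AB: "disjnt A B"
    and D: "\<And>n C. C \<subseteq> D n \<Longrightarrow> closedin X C"
    and cover: "topspace X \<subseteq> A \<union> B \<union> (\<Union>n. D n)"
  obtains P Q where "openin X P" "openin X Q" "A \<subseteq> P" "B \<subseteq> Q" "disjnt P Q" "topspace X = P \<union> Q"
proof -
  define good where "good = (\<lambda>(E, F). closedin X E \<and> closedin X F \<and> disjnt E F \<and> A \<subseteq> E \<and> B \<subseteq> F)"
  define grows where "grows = (\<lambda>n (E, F) (E', F'). E \<subseteq> X interior_of E' \<and> F \<subseteq> X interior_of F'
    \<and> D n \<subseteq> E' \<union> F')"
  have "\<exists>q. good q \<and> grows n p q" if "good p" for n p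
  proof -
    obtain E F where p: "p = (E, F)"
      by fastforce
    \<comment> \<open>The points of \<open>D n\<close> outside \<open>F\<close> all go to the first
      side. Subtracting \<open>F\<close> keeps the sides disjoint, and the difference is closed
      because every subset of \<open>D n\<close> is.\<close>
    have "closedin X (E \<union> (D n - F))" "closedin X F" "disjnt (E \<union> (D n - F)) F"
      using that D[of "D n - F" n] by (auto simp: good_def p disjnt_iff)
    from normal_space_disjoint_closed_neighbourhoods[OF X this]
    obtain E' F' where EF: "closedin X E'" "closedin X F'" "disjnt E' F'"
      "E \<union> (D n - F) \<subseteq> X interior_of E'" "F \<subseteq> X interior_of F'"
      by metis
    then have "good (E', F') \<and> grows n p (E', F')"
      using that interior_of_subset[of X E'] interior_of_subset[of X F']
      unfolding good_def grows_def p prod.case by blast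
    then show ?thesis
      by blast
  qed
  moreover have "good (A, B)"
    using A B AB by (simp add: good_def)
  \<comment> \<open>The conjunct for \<open>n = 0\<close> pins the start of the chosen sequence to
    \<open>(A, B)\<close>.\<close>
  ultimately have "\<exists>f. \<forall>n. (good (f n) \<and> (n = 0 \<longrightarrow> f n = (A, B))) \<and> grows n (f n) (f (Suc n))"
    by (intro dependent_nat_choice) auto
  then obtain f where f: "\<And>n. good (f n)" "\<And>n. grows n (f n) (f (Suc n))" "f 0 = (A, B)"
    by blast
  define E F where "E n = fst (f n)" and "F n = snd (f n)" for n
  have good: "disjnt (E n) (F n)" "closedin X (E n)" "closedin X (F n)" for n
    using f(1)[of n] by (auto simp: good_def E_def F_def split: prod.splits)
  have grows: "E n \<subseteq> X interior_of E (Suc n)" "F n \<subseteq> X interior_of F (Suc n)"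
    "D n \<subseteq> E (Suc n) \<union> F (Suc n)" for n
    using f(2)[of n] by (auto simp: grows_def E_def F_def split: prod.splits)
  have zero: "E 0 = A" "F 0 = B"
    using f(3) by (auto simp: E_def F_def)
  have "E n \<subseteq> E (Suc n)" "F n \<subseteq> F (Suc n)" for n
    using grows(1,2)[of n] interior_of_subset[of X] by (meson order_trans)+
  then have mono: "mono E" "mono F"
    by (simp_all add: mono_iff_le_Suc)
  have union: "openin X (\<Union>n. G n)"
    if "\<And>n. G n \<subseteq> X interior_of G (Suc n)" for G :: "nat \<Rightarrow> 'a set"
  proof -
    have "(\<Union>n. G n) = (\<Union>n. X interior_of G n)"
    proof
      show "(\<Union>n. G n) \<subseteq> (\<Union>n. X interior_of G n)"
        using that by blast
      show "(\<Union>n. X interior_of G n) \<subseteq> (\<Union>n. G n)"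
        by (intro UN_mono subset_refl interior_of_subset)
    qed
    then show ?thesis
      by auto
  qed
  show thesis
  proof
    show "openin X (\<Union>n. E n)" "openin X (\<Union>n. F n)"
      using union grows(1,2) by blast+
    show "A \<subseteq> (\<Union>n. E n)" "B \<subseteq> (\<Union>n. F n)"
      using zero by auto
    show "disjnt (\<Union>n. E n) (\<Union>n. F n)"
    proof -
      \<comment> \<open>By monotonicity both sets lie in the pair with index \<open>max m n\<close>,
        whose members are disjoint.\<close>
      have "disjnt (E m) (F n)" for m n
        using good(1)[of "max m n"] monoD[OF mono(1), of m "max m n"] monoD[OF mono(2), of n "max m n"]
        by (meson disjnt_subset1 disjnt_subset2 max.cobounded1 max.cobounded2)
      then show ?thesis
        by (auto simp: disjnt_iff)
    qed
    have "D n \<subseteq> (\<Union>n. E n) \<union> (\<Union>n. F n)" for n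
      using grows(3)[of n] by blast
    then have "A \<union> B \<union> (\<Union>n. D n) \<subseteq> (\<Union>n. E n) \<union> (\<Union>n. F n)"
      unfolding zero[symmetric] by blast
    moreover have "(\<Union>n. E n) \<union> (\<Union>n. F n) \<subseteq> topspace X"
      using good(2,3)[THEN closedin_subset] by blast
    ultimately show "topspace X = (\<Union>n. E n) \<union> (\<Union>n. F n)"
      using cover by (meson order_trans subset_antisym)
  qed
qed

text \<open>The nodec condition concerns the whole space, whereas first category of \<open>U\<close>
  is stated in the subspace. An open \<open>W\<close> inside the closure of \<open>N\<close> has
  empty trace on \<open>U\<close>, so it misses \<open>N\<close> and hence its closure.\<close>

lemma bi_nowhere_dense_open_subtopology:
  assumes U: "openin T U" and N: "bi_nowhere_dense (subtopology T U) (subtopology T U) N"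
  shows "bi_nowhere_dense T T N"
proof -
  have NU: "N \<subseteq> topspace T" "N \<subseteq> U"
    using N by (auto simp: bi_nowhere_dense_def)
  define W where "W = T interior_of (T closure_of N)"
  have W: "openin T W" "W \<subseteq> T closure_of N"
    by (simp_all add: W_def interior_of_subset)
  have "openin (subtopology T U) (W \<inter> U)"
    using W(1) openin_subtopology by blast
  moreover have "W \<inter> U \<subseteq> subtopology T U closure_of N"
    using W(2) NU by (auto simp: closure_of_subtopology inf.absorb2)
  ultimately have "W \<inter> U = {}"
    using N interior_of_maximal unfolding bi_nowhere_dense_def by blast
  then have "W \<inter> N = {}"
    using NU by blast
  then have "W = {}"
    using W by (metis inf.orderE openin_Int_closure_of_eq_empty)
  then show ?thesis
    using NU by (simp add: bi_nowhere_dense_def W_def)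
qed

lemma bi_nowhere_dense_subset:
  assumes "bi_nowhere_dense S T N" "M \<subseteq> N"
  shows "bi_nowhere_dense S T M"
  using assms interior_of_mono[OF closure_of_mono[OF assms(2)], of S T]
  by (auto simp: bi_nowhere_dense_def)

lemma WS_supernormal_imp_topologies_eq:
  assumes "bitopological_space S T" "\<And>U. openin S U \<Longrightarrow> openin T U" "t1_space S"
    and WS: "\<And>Y. closedin T Y \<Longrightarrow> WS_supernormal_in S T Y"
  shows "S = T"
proof -
  have top: "topspace S = topspace T"
    using assms(1) by (simp add: bitopological_space_def)
  have "openin S G" if G: "openin T G" for G
  proof (subst openin_subopen, intro ballI)
    fix x assume x: "x \<in> G"
    define Y where "Y = topspace T - G"
    have Y: "closedin T Y"
      using G by (simp add: Y_def closedin_diff)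
    \<comment> \<open>WS-supernormality needs \<open>{x}\<close> closed in the finer topology
      \<open>T\<close>, which follows from closedness in \<open>S\<close>.\<close>
    have "closedin S {x}"
      using assms(3) x G openin_subset by (fastforce simp: t1_space_closedin_singleton top)
    then have "closedin T {x}"
      using assms(2) top by (simp add: closedin_def)
    moreover have "closedin (subtopology S Y) Y"
      using closedin_topspace[of "subtopology S Y"] closedin_subset[OF Y]
      by (simp add: top inf.absorb2)
    moreover have "disjnt Y {x}"
      using x by (simp add: Y_def)
    ultimately obtain V where "openin S V" "{x} \<subseteq> V" "disjnt Y V"
      using WS[OF Y] unfolding WS_supernormal_in_def by (meson disjnt_subset1)
    then show "\<exists>V. openin S V \<and> x \<in> V \<and> V \<subseteq> G"
      using openin_subset[of S V] by (intro exI[of _ V]) (auto simp: Y_def disjnt_iff top)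
  qed
  then show ?thesis
    using assms(2) by (metis topology_eq)
qed

lemma connected_normal_nodec_Baire:
  assumes "normal_space T" "connected_space T" "bi_nodec T T" "t1_space T"
  shows "bi_Baire_space T T"
  unfolding bi_Baire_space_def
proof (intro allI impI notI)
  fix U
  assume U: "openin T U \<and> U \<noteq> {}" and "bi_first_category (subtopology T U) (subtopology T U)"
  then obtain \<A> where \<A>: "countable \<A>" "U = \<Union>\<A>"
      "\<And>N. N \<in> \<A> \<Longrightarrow> bi_nowhere_dense (subtopology T U) (subtopology T U) N"
    unfolding bi_first_category_def by (metis inf.absorb_iff2 openin_subset topspace_subtopology)
  have nd: "bi_nowhere_dense T T N" if "N \<in> \<A>" for N
    using U \<A>(3) that bi_nowhere_dense_open_subtopology by blast
  obtain x where x: "x \<in> U" "x \<in> topspace T"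
    using U openin_subset by blast
  \<comment> \<open>In a one-point space, a member of the cover containing \<open>x\<close> would be
    the whole space, which is not nowhere dense.\<close>
  have "topspace T \<noteq> {x}"
  proof
    assume top: "topspace T = {x}"
    obtain N where "N \<in> \<A>" "x \<in> N"
      using x \<A>(2) by blast
    then have "bi_nowhere_dense T T (topspace T)"
      using nd bi_nowhere_dense_subset top by (metis empty_subsetI insert_subset)
    then show False
      using x by (simp add: bi_nowhere_dense_def)
  qed
  then obtain y where y: "y \<in> topspace T" "y \<noteq> x"
    using x by blast
  obtain D :: "nat \<Rightarrow> 'a set" where D: "range D = \<A>"
    using \<A>(1,2) U by (metis Union_empty uncountable_def)
  have "closedin T C" if "C \<subseteq> D n" for n C
  proof -
    have "bi_nowhere_dense T T (D n)"
      using nd D by blast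
    then have "bi_nowhere_dense T T C"
      using that by (rule bi_nowhere_dense_subset)
    then show ?thesis
      using assms(3) by (simp add: bi_nodec_def)
  qed
  \<comment> \<open>These are the two starting sets. Adding \<open>y\<close> keeps the second one
    nonempty even if \<open>U\<close> is the whole space, so both sides of the final partition are
    nonempty.\<close>
  moreover have "closedin T {x}" "closedin T (insert y (topspace T - U))"
    using assms(4) x y U closedin_Un[of T "{y}" "topspace T - U"]
    by (simp_all add: t1_space_closedin_singleton closedin_diff)
  moreover have "disjnt {x} (insert y (topspace T - U))"
    using x y by simp
  moreover have "topspace T \<subseteq> {x} \<union> insert y (topspace T - U) \<union> (\<Union>n. D n)"
    using D \<A>(2) by auto
  ultimately obtain P Q where PQ: "openin T P" "openin T Q" "{x} \<subseteq> P" "insert y (topspace T - U) \<subseteq> Q"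
      "disjnt P Q" "topspace T = P \<union> Q"
    using normal_space_clopen_partition[OF assms(1)] by metis
  then have "P \<noteq> {}" "Q \<noteq> {}"
    by blast+
  then show False
    using assms(2) PQ unfolding connected_space_def disjnt_def by (metis subset_refl)
qed

theorem theorem3p13:
  fixes \<tau>\<^sub>1 \<tau>\<^sub>2 :: "'a topology"
  assumes "bitopological_space \<tau>\<^sub>1 \<tau>\<^sub>2"
    and "less_C \<tau>\<^sub>1 \<tau>\<^sub>2"
    and "p_normal \<tau>\<^sub>1 \<tau>\<^sub>2"
    and "p_connected \<tau>\<^sub>1 \<tau>\<^sub>2"
    and "bi_nodec \<tau>\<^sub>2 \<tau>\<^sub>1"
    and "t1_space \<tau>\<^sub>1"
    and "\<And>Y. closedin \<tau>\<^sub>2 Y \<Longrightarrow> WS_supernormal_in \<tau>\<^sub>1 \<tau>\<^sub>2 Y"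
  shows "bi_Baire_space \<tau>\<^sub>1 \<tau>\<^sub>2 \<and> Baire_space \<tau>\<^sub>1"
proof -
  have eq: "\<tau>\<^sub>1 = \<tau>\<^sub>2"
    using assms(1,2,6,7) by (intro WS_supernormal_imp_topologies_eq) (auto simp: less_C_def)
  \<comment> \<open>Once the topologies agree, the pairwise notions become the ordinary
    ones.\<close>
  have "normal_space \<tau>\<^sub>1"
    using assms(3) by (simp add: eq p_normal_def normal_space_def)
  moreover have "connected_space \<tau>\<^sub>1"
    using assms(4) unfolding eq p_connected_def connected_space_eq disjnt_def by blast
  ultimately have "bi_Baire_space \<tau>\<^sub>1 \<tau>\<^sub>1"
    using assms(5,6) by (simp add: eq connected_normal_nodec_Baire)
  then show ?thesis
    by (simp add: eq Baire_space_iff_bi_Baire_space)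
qed

end
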